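(* Let $\Gamma$ be a simplicial graph with vertex set $V(\Gamma)$, and let $A_\Gamma$ be the right-angled Artin group defined by $\Gamma$. Suppose there are adjacent vertices $a,b \in V(\Gamma)$ with $a \le b$ (that is, $\operatorname{lk}(a) \subset \operatorname{st}(b)$), such that $b$ is not adjacent to all the other vertices of $\Gamma$. Then the three-dimensional integer Heisenberg group $H_3(\mathbb{Z})$ is (isomorphic to) a subgroup of the automorphism group $\operatorname{Aut}(A_\Gamma)$.
   Context: A simplicial graph is a graph without loops or multiple edges; $V(\Gamma)$ and $E(\Gamma)$ denote its sets of vertices and edges. The right-angled Artin group $A_\Gamma$ is the group generated by $V(\Gamma)$ with defining relations $[v,w]=1$ exactly for those pairs $v,w$ with $vw \in E(\Gamma)$. For a vertex $v$, the link $\operatorname{lk}(v)$ is the set of vertices adjacent to $v$, and the star is $\operatorname{st}(v)=\operatorname{lk}(v)\cup\{v\}$. For $v,w\in V(\Gamma)$, one writes $v \le w$ if $\operatorname{lk}(v)\subset \operatorname{st}(w)$. $H_3(\mathbb{Z})$ is the group with presentation $\langle A,B,C \mid [A,C]=[B,C]=1,\ [A,B]=C\rangle$, where $[x,y]$ denotes the commutator $xyx^{-1}y^{-1}$. *)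

theory Defs
  imports "HOL-Algebra.Bij"
begin

section \<open>Group presentations\<close>

text \<open>
  A letter \<open>(x, True)\<close> stands for the generator \<open>x\<close> and \<open>(x, False)\<close> for its formal inverse.
\<close>

type_synonym 'a gword = "('a \<times> bool) list"

definition gwords :: "'a set \<Rightarrow> 'a gword set" where
  "gwords S = lists (S \<times> UNIV)"

definition gen :: "'a \<Rightarrow> 'a gword" where
  "gen x = [(x, True)]"

definition inv_gword :: "'a gword \<Rightarrow> 'a gword" where
  "inv_gword u = rev (map (apsnd Not) u)"

definition comm_gword :: "'a gword \<Rightarrow> 'a gword \<Rightarrow> 'a gword" where
  "comm_gword u v = u @ v @ inv_gword u @ inv_gword v"

text \<open>
  Equality of words over \<open>S\<close> in the group with generating set \<open>S\<close> and defining relations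
  \<open>u = v\<close> for \<open>(u, v) \<in> R\<close>: the least congruence on the monoid \<open>gwords S\<close> that contains the
  free cancellations and the defining relations.
\<close>

inductive pres_eq :: "'a set \<Rightarrow> ('a gword \<times> 'a gword) set \<Rightarrow> 'a gword \<Rightarrow> 'a gword \<Rightarrow> bool"
  for S :: "'a set" and R :: "('a gword \<times> 'a gword) set"
where
  refl: "u \<in> gwords S \<Longrightarrow> pres_eq S R u u"
| sym: "pres_eq S R u v \<Longrightarrow> pres_eq S R v u"
| trans: "pres_eq S R u v \<Longrightarrow> pres_eq S R v w \<Longrightarrow> pres_eq S R u w"
| append: "pres_eq S R u u' \<Longrightarrow> pres_eq S R v v' \<Longrightarrow> pres_eq S R (u @ v) (u' @ v')"
| cancel: "x \<in> S \<Longrightarrow> pres_eq S R [(x, e), (x, \<not> e)] []"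
| relation: "(u, v) \<in> R \<Longrightarrow> u \<in> gwords S \<Longrightarrow> v \<in> gwords S \<Longrightarrow> pres_eq S R u v"

definition pres_rel :: "'a set \<Rightarrow> ('a gword \<times> 'a gword) set \<Rightarrow> ('a gword \<times> 'a gword) set" where
  "pres_rel S R = {(u, v). pres_eq S R u v}"

text \<open>
  The product of classes is written as a union over representatives; since \<open>pres_eq\<close> is a
  congruence, that union is the single class of \<open>u @ v\<close> (lemma \<open>mult_presented_group\<close> below).
\<close>

definition presented_group :: "'a set \<Rightarrow> ('a gword \<times> 'a gword) set \<Rightarrow> 'a gword set monoid" where
  "presented_group S R =
    \<lparr>carrier = gwords S // pres_rel S R,
     mult = (\<lambda>X Y. \<Union>u\<in>X. \<Union>v\<in>Y. pres_rel S R `` {u @ v}),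
     one = pres_rel S R `` {[]}\<rparr>"

lemma pres_eq_in_gwords: "pres_eq S R u v \<Longrightarrow> u \<in> gwords S \<and> v \<in> gwords S"
  by (induction rule: pres_eq.induct) (auto simp: gwords_def)

lemma equiv_pres_rel: "equiv (gwords S) (pres_rel S R)"
  by (rule equivI)
    (auto simp: pres_rel_def refl_on_def sym_def trans_def dest: pres_eq_in_gwords
      intro: pres_eq.refl pres_eq.sym pres_eq.trans)

lemma pres_class_eq: "pres_eq S R u v \<Longrightarrow> pres_rel S R `` {u} = pres_rel S R `` {v}"
  by (rule equiv_class_eq[OF equiv_pres_rel]) (simp add: pres_rel_def)

lemma carrier_presented_group: "carrier (presented_group S R) = gwords S // pres_rel S R"
  by (simp add: presented_group_def)

lemma one_presented_group: "\<one>\<^bsub>presented_group S R\<^esub> = pres_rel S R `` {[]}"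
  by (simp add: presented_group_def)

lemma mult_presented_group:
  assumes "u \<in> gwords S" "v \<in> gwords S"
  shows "pres_rel S R `` {u} \<otimes>\<^bsub>presented_group S R\<^esub> pres_rel S R `` {v} = pres_rel S R `` {u @ v}"
proof -
  have "congruent2 (pres_rel S R) (pres_rel S R) (\<lambda>u v. pres_rel S R `` {u @ v})"
    by (rule congruent2I') (rule pres_class_eq, simp add: pres_rel_def pres_eq.append)
  then show ?thesis
    unfolding presented_group_def
    by (simp add: UN_equiv_class2[OF equiv_pres_rel equiv_pres_rel _ assms])
qed

lemma inv_gword_in_gwords: "u \<in> gwords S \<Longrightarrow> inv_gword u \<in> gwords S"
  by (induction u) (auto simp: gwords_def inv_gword_def)

lemma inv_gword_cancel:
  assumes "u \<in> gwords S"
  shows "pres_eq S R (inv_gword u @ u) []"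
  using assms
proof (induction u)
  case Nil
  then show ?case by (simp add: inv_gword_def pres_eq.refl)
next
  case (Cons a u)
  obtain x e where a: "a = (x, e)" by (cases a)
  have x: "x \<in> S" and u: "u \<in> gwords S" using Cons.prems a by (auto simp: gwords_def)
  have "pres_eq S R [(x, \<not> e), (x, e)] []"
    using pres_eq.cancel[OF x, of R "\<not> e"] by simp
  then have "pres_eq S R (inv_gword u @ [(x, \<not> e), (x, e)] @ u) (inv_gword u @ [] @ u)"
    by (intro pres_eq.append pres_eq.refl inv_gword_in_gwords u)
  then have "pres_eq S R (inv_gword (a # u) @ (a # u)) (inv_gword u @ u)"
    by (simp add: a inv_gword_def)
  then show ?case using Cons.IH[OF u] by (rule pres_eq.trans)
qed

lemma group_presented_group: "group (presented_group S R)"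
proof (rule groupI)
  let ?G = "presented_group S R"
  have app: "u @ v \<in> gwords S" if "u \<in> gwords S" "v \<in> gwords S" for u v :: "'a gword"
    using that by (auto simp: gwords_def)
  have nil: "[] \<in> gwords S" by (simp add: gwords_def)
  show "\<one>\<^bsub>?G\<^esub> \<in> carrier ?G"
    by (simp add: one_presented_group carrier_presented_group quotientI nil)
  fix X assume "X \<in> carrier ?G"
  then obtain u where u: "u \<in> gwords S" "X = pres_rel S R `` {u}"
    by (auto simp: carrier_presented_group elim: quotientE)
  show "\<one>\<^bsub>?G\<^esub> \<otimes>\<^bsub>?G\<^esub> X = X"
    by (simp add: u one_presented_group mult_presented_group nil)
  have "pres_rel S R `` {inv_gword u} \<otimes>\<^bsub>?G\<^esub> X = \<one>\<^bsub>?G\<^esub>"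
    by (simp add: u one_presented_group mult_presented_group inv_gword_in_gwords
        pres_class_eq[OF inv_gword_cancel])
  then show "\<exists>Y\<in>carrier ?G. Y \<otimes>\<^bsub>?G\<^esub> X = \<one>\<^bsub>?G\<^esub>"
    using inv_gword_in_gwords[OF u(1)] by (auto simp: carrier_presented_group intro: quotientI)
  fix Y assume "Y \<in> carrier ?G"
  then obtain v where v: "v \<in> gwords S" "Y = pres_rel S R `` {v}"
    by (auto simp: carrier_presented_group elim: quotientE)
  show "X \<otimes>\<^bsub>?G\<^esub> Y \<in> carrier ?G"
    by (simp add: u v mult_presented_group carrier_presented_group quotientI app)
  fix Z assume "Z \<in> carrier ?G"
  then obtain w where w: "w \<in> gwords S" "Z = pres_rel S R `` {w}"
    by (auto simp: carrier_presented_group elim: quotientE)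
  show "X \<otimes>\<^bsub>?G\<^esub> Y \<otimes>\<^bsub>?G\<^esub> Z = X \<otimes>\<^bsub>?G\<^esub> (Y \<otimes>\<^bsub>?G\<^esub> Z)"
    by (simp add: u v w mult_presented_group app)
qed


section \<open>Simplicial graphs and right-angled Artin groups\<close>

definition simplicial_graph :: "'a set \<Rightarrow> 'a set set \<Rightarrow> bool" where
  "simplicial_graph V E \<longleftrightarrow> (\<forall>e\<in>E. e \<subseteq> V \<and> card e = 2)"

definition lk :: "'a set \<Rightarrow> 'a set set \<Rightarrow> 'a \<Rightarrow> 'a set" where
  "lk V E v = {w \<in> V. {v, w} \<in> E}"

definition st :: "'a set \<Rightarrow> 'a set set \<Rightarrow> 'a \<Rightarrow> 'a set" where
  "st V E v = lk V E v \<union> {v}"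

definition vertex_le :: "'a set \<Rightarrow> 'a set set \<Rightarrow> 'a \<Rightarrow> 'a \<Rightarrow> bool" where
  "vertex_le V E v w \<longleftrightarrow> lk V E v \<subseteq> st V E w"

definition raag :: "'a set \<Rightarrow> 'a set set \<Rightarrow> 'a gword set monoid" where
  "raag V E = presented_group V
    {(comm_gword (gen v) (gen w), []) | v w. v \<in> V \<and> w \<in> V \<and> {v, w} \<in> E}"


section \<open>The integer Heisenberg group\<close>

datatype heis_gen = HA | HB | HC

definition heisenberg3 :: "heis_gen gword set monoid" where
  "heisenberg3 = presented_group UNIV
    {(comm_gword (gen HA) (gen HC), []),
     (comm_gword (gen HB) (gen HC), []),
     (comm_gword (gen HA) (gen HB), gen HC)}"

end

theory Submission
  imports Defs "HOL-Algebra.Coset"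
begin

text \<open>
  Pick a vertex \<open>c\<close> that is neither \<open>b\<close> nor adjacent to it; since \<open>a \<le> b\<close>, it is not adjacent to \<open>a\<close>
  either. Because \<open>a \<le> b\<close>, the transvection \<open>\<tau>: a \<mapsto> a b\<close> is an automorphism of the right-angled
  Artin group. Let \<open>\<gamma>\<^sub>x\<close> be conjugation by \<open>x\<close>. As \<open>\<tau> \<gamma>\<^sub>x \<tau>\<^sup>-\<^sup>1\<close> is conjugation by \<open>\<tau> x\<close> and \<open>a\<close>, \<open>b\<close>
  commute, \<open>[\<tau>, \<gamma>\<^sub>a] = \<gamma>\<^sub>b\<close> while \<open>\<gamma>\<^sub>b\<close> commutes with both, so \<open>A, B, C \<mapsto> \<tau>, \<gamma>\<^sub>a, \<gamma>\<^sub>b\<close> defines a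
  homomorphism from the Heisenberg group. An element \<open>\<tau>\<^sup>i \<gamma>\<^sub>g\<close> of its image with \<open>g = a\<^sup>j b\<^sup>k\<close> sends \<open>a\<close> to \<open>a b\<^sup>i\<close>,
  hence is trivial only if \<open>i = 0\<close> and \<open>g\<close> commutes with \<open>c\<close>. Killing all generators except \<open>b, c\<close>
  (or \<open>a, c\<close>), which may go to any two elements, shows that then \<open>j = k = 0\<close>. The integer Heisenberg
  group itself is used as the target of these two maps.
\<close>

section \<open>The universal property of a presented group\<close>

primrec eval_gword :: "('b, 'm) monoid_scheme \<Rightarrow> ('a \<Rightarrow> 'b) \<Rightarrow> 'a gword \<Rightarrow> 'b" where
  "eval_gword G f [] = \<one>\<^bsub>G\<^esub>"
| "eval_gword G f (p # u) =
    (if snd p then f (fst p) else inv\<^bsub>G\<^esub> f (fst p)) \<otimes>\<^bsub>G\<^esub> eval_gword G f u"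

definition pres_gen :: "'a set \<Rightarrow> ('a gword \<times> 'a gword) set \<Rightarrow> 'a \<Rightarrow> 'a gword set" where
  "pres_gen S R x = pres_rel S R `` {gen x}"

lemma gwords_simps [simp]:
  "[] \<in> gwords S"
  "p # u \<in> gwords S \<longleftrightarrow> fst p \<in> S \<and> u \<in> gwords S"
  "u @ v \<in> gwords S \<longleftrightarrow> u \<in> gwords S \<and> v \<in> gwords S"
  by (auto simp: gwords_def mem_Times_iff)

lemma gen_in_gwords [simp]: "gen x \<in> gwords S \<longleftrightarrow> x \<in> S"
  by (simp add: gen_def)

context group
begin

lemma eval_gword_closed [simp]:
  "f \<in> S \<rightarrow> carrier G \<Longrightarrow> u \<in> gwords S \<Longrightarrow> eval_gword G f u \<in> carrier G"
  by (induction u) (auto simp: Pi_iff)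

lemma eval_gword_append:
  "f \<in> S \<rightarrow> carrier G \<Longrightarrow> u \<in> gwords S \<Longrightarrow> v \<in> gwords S \<Longrightarrow>
    eval_gword G f (u @ v) = eval_gword G f u \<otimes> eval_gword G f v"
proof (induction u)
  case (Cons p u)
  then have "f (fst p) \<in> carrier G" "eval_gword G f u \<in> carrier G" "eval_gword G f v \<in> carrier G"
    by auto
  with Cons show ?case by (simp add: m_assoc)
qed auto

text \<open>Since \<open>inv x \<otimes> inv y\<close> is the inverse of
  \<open>y \<otimes> x\<close>, a commutator relator becomes an exchange rule. With
  \<open>z = \<one>\<close> the rule says that \<open>x\<close> and \<open>y\<close>
  commute.\<close>

lemma commutator_eq_iff:
  assumes "x \<in> carrier G" "y \<in> carrier G" "z \<in> carrier G"
  shows "x \<otimes> y \<otimes> inv x \<otimes> inv y = z \<longleftrightarrow> x \<otimes> y = z \<otimes> (y \<otimes> x)"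
proof -
  have "x \<otimes> y \<otimes> inv x \<otimes> inv y = x \<otimes> y \<otimes> inv (y \<otimes> x)"
    using assms by (simp add: m_assoc inv_mult_group)
  then show ?thesis
    using inv_solve_right[of z "x \<otimes> y" "y \<otimes> x"] assms by (metis m_closed)
qed

lemma eval_gword_comm:
  assumes "f x \<in> carrier G" "f y \<in> carrier G"
  shows "eval_gword G f (comm_gword (gen x) (gen y)) = f x \<otimes> f y \<otimes> inv f x \<otimes> inv f y"
  using assms by (simp add: comm_gword_def gen_def inv_gword_def m_assoc)

lemma eval_gword_gen: "f x \<in> carrier G \<Longrightarrow> eval_gword G f (gen x) = f x"
  by (simp add: gen_def)

text \<open>Equality in the target group respects every rule generating \<open>pres_eq\<close>, so
  evaluation is constant on classes as soon as it respects the defining relations.\<close>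

lemma eval_gword_cong:
  assumes f: "f \<in> S \<rightarrow> carrier G"
    and rels: "\<And>u v. (u, v) \<in> R \<Longrightarrow> u \<in> gwords S \<Longrightarrow> v \<in> gwords S \<Longrightarrow>
      eval_gword G f u = eval_gword G f v"
    and "pres_eq S R u v"
  shows "eval_gword G f u = eval_gword G f v"
  using assms(3)
proof (induction rule: pres_eq.induct)
  case (append u u' v v')
  then show ?case using pres_eq_in_gwords[of S R] eval_gword_append[OF f] by metis
next
  case (cancel x e)
  then have "f x \<in> carrier G" using f by auto
  then show ?case by (cases e) auto
qed (auto intro: rels)

lemma presented_group_lift:
  assumes f: "f \<in> S \<rightarrow> carrier G"
    and rels: "\<And>u v. (u, v) \<in> R \<Longrightarrow> u \<in> gwords S \<Longrightarrow> v \<in> gwords S \<Longrightarrow>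
      eval_gword G f u = eval_gword G f v"
  obtains h where "h \<in> hom (presented_group S R) G"
    and "\<And>x. x \<in> S \<Longrightarrow> h (pres_gen S R x) = f x"
proof
  \<comment> \<open>Evaluate an arbitrary representative of the class; by
    \<open>eval_gword_cong\<close> the choice does not matter.\<close>
  define h where "h X = eval_gword G f (SOME u. u \<in> X)" for X
  have h: "h (pres_rel S R `` {u}) = eval_gword G f u" if "u \<in> gwords S" for u
  proof -
    have "u \<in> pres_rel S R `` {u}" using that by (simp add: pres_rel_def pres_eq.refl)
    then have "(SOME v. v \<in> pres_rel S R `` {u}) \<in> pres_rel S R `` {u}" by (rule someI)
    then have "pres_eq S R u (SOME v. v \<in> pres_rel S R `` {u})" by (simp add: pres_rel_def)
    from eval_gword_cong[OF f rels this] show ?thesis by (simp add: h_def)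
  qed
  show "h \<in> hom (presented_group S R) G"
  proof (rule homI)
    fix X assume "X \<in> carrier (presented_group S R)"
    then obtain u where u: "u \<in> gwords S" "X = pres_rel S R `` {u}"
      by (auto simp: carrier_presented_group elim: quotientE)
    show "h X \<in> carrier G" using u f by (simp add: h)
    fix Y assume "Y \<in> carrier (presented_group S R)"
    then obtain v where v: "v \<in> gwords S" "Y = pres_rel S R `` {v}"
      by (auto simp: carrier_presented_group elim: quotientE)
    show "h (X \<otimes>\<^bsub>presented_group S R\<^esub> Y) = h X \<otimes> h Y"
      using u v by (simp add: h mult_presented_group eval_gword_append[OF f])
  qed
  show "h (pres_gen S R x) = f x" if "x \<in> S" for x
    using that funcset_mem[OF f that] by (simp add: pres_gen_def h eval_gword_gen)
qed

end

lemma pres_gen_closed [simp]: "x \<in> S \<Longrightarrow> pres_gen S R x \<in> carrier (presented_group S R)"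
  by (simp add: pres_gen_def carrier_presented_group quotientI)

lemma inv_pres_gen:
  assumes "x \<in> S"
  shows "inv\<^bsub>presented_group S R\<^esub> pres_gen S R x = pres_rel S R `` {[(x, False)]}"
proof (rule group.inv_equality[OF group_presented_group])
  show "pres_rel S R `` {[(x, False)]} \<otimes>\<^bsub>presented_group S R\<^esub> pres_gen S R x =
      \<one>\<^bsub>presented_group S R\<^esub>"
    using assms pres_class_eq[OF pres_eq.cancel[of x S R False]]
    by (simp add: pres_gen_def gen_def mult_presented_group one_presented_group)
qed (use assms in \<open>simp_all, simp add: carrier_presented_group quotientI\<close>)

text \<open>Every element of the presented group is thus the value of a word in its own generators,
  which turns relations and inductions on words into statements about group elements.\<close>

lemma eval_gword_pres_gen:
  "u \<in> gwords S \<Longrightarrow> eval_gword (presented_group S R) (pres_gen S R) u = pres_rel S R `` {u}"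
proof (induction u)
  case Nil
  then show ?case by (simp add: one_presented_group)
next
  case (Cons p u)
  obtain x e where p: "p = (x, e)" by (cases p)
  with Cons show ?case
    by (cases e) (auto simp: inv_pres_gen, auto simp: pres_gen_def gen_def mult_presented_group)
qed

lemma presented_group_relation:
  assumes "(u, v) \<in> R" "u \<in> gwords S" "v \<in> gwords S"
  shows "eval_gword (presented_group S R) (pres_gen S R) u =
    eval_gword (presented_group S R) (pres_gen S R) v"
  using assms by (simp add: eval_gword_pres_gen pres_class_eq[OF pres_eq.relation])

lemma presented_group_induct [consumes 1, case_names one gen inv_gen]:
  assumes "X \<in> carrier (presented_group S R)"
    and "P \<one>\<^bsub>presented_group S R\<^esub>"
    and "\<And>x Y. x \<in> S \<Longrightarrow> Y \<in> carrier (presented_group S R) \<Longrightarrow> P Y \<Longrightarrow>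
      P (pres_gen S R x \<otimes>\<^bsub>presented_group S R\<^esub> Y)"
    and "\<And>x Y. x \<in> S \<Longrightarrow> Y \<in> carrier (presented_group S R) \<Longrightarrow> P Y \<Longrightarrow>
      P (inv\<^bsub>presented_group S R\<^esub> pres_gen S R x \<otimes>\<^bsub>presented_group S R\<^esub> Y)"
  shows "P X"
proof -
  interpret G: group "presented_group S R" by (rule group_presented_group)
  have gens: "pres_gen S R \<in> S \<rightarrow> carrier (presented_group S R)" by simp
  have "P (eval_gword (presented_group S R) (pres_gen S R) u)" if "u \<in> gwords S" for u
    using that by (induction u) (use assms(2-4) G.eval_gword_closed[OF gens] in auto)
  moreover obtain u where "u \<in> gwords S" "X = pres_rel S R `` {u}"
    using assms(1) by (auto simp: carrier_presented_group elim: quotientE)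
  ultimately show ?thesis by (metis eval_gword_pres_gen)
qed

lemma presented_group_subset_subgroup:
  assumes N: "subgroup N (presented_group S R)" and gens: "\<And>x. x \<in> S \<Longrightarrow> pres_gen S R x \<in> N"
  shows "carrier (presented_group S R) \<subseteq> N"
proof
  fix X assume "X \<in> carrier (presented_group S R)"
  then show "X \<in> N"
    by (induction rule: presented_group_induct)
      (simp_all add: subgroup.one_closed[OF N] subgroup.m_closed[OF N]
        subgroup.m_inv_closed[OF N] gens)
qed

lemma presented_group_hom_eqI:
  assumes "group K" and h: "h \<in> hom (presented_group S R) K" and k: "k \<in> hom (presented_group S R) K"
    and eq: "\<And>x. x \<in> S \<Longrightarrow> h (pres_gen S R x) = k (pres_gen S R x)"
    and "X \<in> carrier (presented_group S R)"
  shows "h X = k X"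
proof -
  interpret h: group_hom "presented_group S R" K h
    by (intro group_hom.intro group_hom_axioms.intro group_presented_group assms)
  interpret k: group_hom "presented_group S R" K k
    by (intro group_hom.intro group_hom_axioms.intro group_presented_group assms)
  show ?thesis
    using assms(5) by (induction rule: presented_group_induct) (simp_all add: eq)
qed


section \<open>The integer Heisenberg group in coordinates\<close>

text \<open>The triple \<open>(i, j, k)\<close> stands for \<open>A\<^sup>i B\<^sup>j C\<^sup>k\<close>; since \<open>A B = C B A\<close>, moving \<open>A\<^sup>i\<close> to the
  left past \<open>B\<^sup>j\<close> costs \<open>C\<close> to the power \<open>- i j\<close>.\<close>

definition heis_int :: "(int \<times> int \<times> int) monoid" where
  "heis_int = \<lparr>carrier = UNIV,
    mult = (\<lambda>(i, j, k) (i', j', k'). (i + i', j + j', k + k' - i' * j)),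
    one = (0, 0, 0)\<rparr>"

lemma carrier_heis_int [simp]: "carrier heis_int = UNIV"
  and mult_heis_int [simp]:
    "(i, j, k) \<otimes>\<^bsub>heis_int\<^esub> (i', j', k') = (i + i', j + j', k + k' - i' * j)"
  and one_heis_int [simp]: "\<one>\<^bsub>heis_int\<^esub> = (0, 0, 0)"
  by (simp_all add: heis_int_def)

lemma group_heis_int: "group heis_int"
proof (rule groupI)
  fix x :: "int \<times> int \<times> int"
  obtain i j k where x: "x = (i, j, k)" by (cases x)
  show "\<exists>y\<in>carrier heis_int. y \<otimes>\<^bsub>heis_int\<^esub> x = \<one>\<^bsub>heis_int\<^esub>"
    \<comment> \<open>Moving \<open>A\<close> to the power \<open>i\<close> past \<open>B\<close> to
      the power \<open>- j\<close> contributes \<open>i * j\<close> to the last coordinate; the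
      witness cancels this.\<close>
    by (rule bexI[of _ "(- i, - j, - k - i * j)"]) (auto simp: x)
qed (auto simp: algebra_simps)

section \<open>Integer powers and conjugation\<close>

text \<open>A homomorphism from the integers is determined by its value at 1. This identifies powers
  whenever an explicit additive family is at hand.\<close>

lemma (in group) int_pow_eqI:
  assumes "\<And>i. h i \<in> carrier G" and add: "\<And>i j. h (i + j) = h i \<otimes> h j"
  shows "h 1 [^] (i :: int) = h i"
proof -
  have 0: "h 0 = \<one>"
    using add[of 0 0] assms(1)[of 0] by simp
  have nat: "h 1 [^] n = h (int n)" for n :: nat
  proof (induction n)
    case (Suc n)
    then show ?case using add[of "int n" 1] by (simp add: add.commute)
  qed (simp add: 0)
  have neg: "inv (h j) = h (- j)" for j
    by (rule inv_equality) (use add[of "- j" j] 0 assms(1) in auto)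
  show ?thesis
    using assms(1) by (cases i rule: int_cases2) (simp_all add: int_pow_int int_pow_neg_int nat neg)
qed

lemma heis_int_pow [simp]:
  "(1, 0, 0) [^]\<^bsub>heis_int\<^esub> (i :: int) = (i, 0, 0)"
  "(0, 1, 0) [^]\<^bsub>heis_int\<^esub> (i :: int) = (0, i, 0)"
  "(0, 0, 1) [^]\<^bsub>heis_int\<^esub> (i :: int) = (0, 0, i)"
  using group.int_pow_eqI[OF group_heis_int, of "\<lambda>i. (i, 0, 0)" i]
    group.int_pow_eqI[OF group_heis_int, of "\<lambda>i. (0, i, 0)" i]
    group.int_pow_eqI[OF group_heis_int, of "\<lambda>i. (0, 0, i)" i]
  by simp_all

context group
begin

lemma int_pow_conj:
  assumes x: "x \<in> carrier G" and y: "y \<in> carrier G"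
  shows "(x \<otimes> y \<otimes> inv x) [^] (n :: int) = x \<otimes> y [^] n \<otimes> inv x"
proof -
  have "x \<otimes> y [^] (i + j) \<otimes> inv x = (x \<otimes> y [^] i \<otimes> inv x) \<otimes> (x \<otimes> y [^] j \<otimes> inv x)" for i j :: int
  proof -
    have "inv x \<otimes> (x \<otimes> (y [^] j \<otimes> inv x)) = y [^] j \<otimes> inv x"
      using x y by (simp flip: m_assoc)
    then show ?thesis using x y by (simp add: m_assoc int_pow_mult)
  qed
  from int_pow_eqI[where h = "\<lambda>n. x \<otimes> y [^] n \<otimes> inv x" and i = n, OF _ this]
  show ?thesis using x y by simp
qed

text \<open>Conjugation by \<open>y\<close> fixes \<open>x\<close>, hence fixes every power of
  \<open>x\<close>.\<close>

lemma int_pow_commute: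
  assumes "x \<in> carrier G" "y \<in> carrier G" "x \<otimes> y = y \<otimes> x"
  shows "x [^] (n :: int) \<otimes> y = y \<otimes> x [^] n"
proof -
  have "y \<otimes> x \<otimes> inv y = x" using assms by (metis inv_solve_right' m_closed)
  then have "x [^] n = y \<otimes> x [^] n \<otimes> inv y" using int_pow_conj[of y x n] assms by simp
  then show ?thesis using assms by (metis inv_solve_right int_pow_closed m_closed)
qed

text \<open>The normal form \<open>A\<^sup>i B\<^sup>j C\<^sup>k\<close> can be evaluated at any
  three elements satisfying the Heisenberg relations. Multiplicativity comes down to the exchange
  rule \<open>yx\<close> for powers of \<open>y\<close> and \<open>x\<close>.\<close>

lemma heis_int_hom:
  assumes x: "x \<in> carrier G" and y: "y \<in> carrier G" and z: "z \<in> carrier G"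
    and xz: "x \<otimes> z = z \<otimes> x" and yz: "y \<otimes> z = z \<otimes> y" and xy: "x \<otimes> y = z \<otimes> (y \<otimes> x)"
  shows "(\<lambda>(i, j, k). x [^] i \<otimes> (y [^] j \<otimes> z [^] k)) \<in> hom heis_int G"
proof (rule homI)
  note closed = x y z int_pow_closed m_closed inv_closed
  have zx': "z [^] n \<otimes> x [^] m = x [^] m \<otimes> z [^] n" for m n :: int
    using int_pow_commute[of x "z [^] n" m] int_pow_commute[of z x n] closed xz by simp
  have zy': "z [^] n \<otimes> y [^] m = y [^] m \<otimes> z [^] n" for m n :: int
    using int_pow_commute[of y "z [^] n" m] int_pow_commute[of z y n] closed yz by simp
  \<comment> \<open>The version with a tail \<open>w\<close> applies inside products associated to
    the right.\<close>
  have zy: "z [^] n \<otimes> (y [^] m \<otimes> w) = y [^] m \<otimes> (z [^] n \<otimes> w)"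
    if "w \<in> carrier G" for m n :: int and w
    using closed zy' that by (metis m_assoc)
  have yxz: "y \<otimes> x \<otimes> inv y = x \<otimes> z [^] (- 1 :: int)"
  proof -
    have "x \<otimes> y = y \<otimes> x \<otimes> z" using xy zx'[of 1 1] zy'[of 1 1] closed
      by (metis int_pow_1 m_assoc)
    then have "y \<otimes> x = x \<otimes> (y \<otimes> inv z)" using closed by (metis inv_solve_right m_assoc)
    also have "y \<otimes> inv z = inv z \<otimes> y" using zy'[of "- 1" 1] closed by (simp add: int_pow_neg)
    finally show ?thesis
      using closed by (metis inv_solve_right' m_assoc int_pow_neg int_pow_1)
  qed
  \<comment> \<open>Take powers of a conjugate twice: first raise
    \<open>y x y\<^sup>-\<^sup>1 = x z\<^sup>-\<^sup>1\<close> to the power \<open>i\<close>, then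
    rewrite the result as a conjugate of \<open>y\<close> by a power of \<open>x\<close> and raise
    that to the power \<open>j\<close>.\<close>
  have yx: "y [^] j \<otimes> x [^] i = x [^] i \<otimes> (y [^] j \<otimes> z [^] (- (i * j)))" for i j :: int
  proof -
    have "y \<otimes> x [^] i \<otimes> inv y = x [^] i \<otimes> z [^] (- i)"
    proof -
      have "y \<otimes> x [^] i \<otimes> inv y = (x \<otimes> z [^] (- 1 :: int)) [^] i"
        using int_pow_conj[of y x i] yxz closed by simp
      also have "\<dots> = x [^] i \<otimes> z [^] (- i)"
        using int_pow_mult_distrib[of x "z [^] (- 1 :: int)" i] zx'[of "- 1" 1] closed
        by (simp add: int_pow_pow)
      finally show ?thesis .
    qed
    then have "y \<otimes> x [^] i = x [^] i \<otimes> (y \<otimes> z [^] (- i))"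
      using closed zy'[of "- i" 1] by (metis inv_solve_right' m_assoc int_pow_1)
    then have "inv (x [^] i) \<otimes> y \<otimes> x [^] i = y \<otimes> z [^] (- i)"
      using closed by (metis inv_solve_left' m_assoc)
    then have "inv (x [^] i) \<otimes> y [^] j \<otimes> x [^] i = (y \<otimes> z [^] (- i)) [^] j"
      using int_pow_conj[of "inv (x [^] i)" y j] closed by simp
    also have "\<dots> = y [^] j \<otimes> z [^] (- (i * j))"
      using int_pow_mult_distrib[of y "z [^] (- i)" j] zy'[of "- i" 1] closed
      by (simp add: int_pow_pow)
    finally show ?thesis using closed by (metis inv_solve_left' m_assoc)
  qed
  fix s t :: "int \<times> int \<times> int"
  obtain i j k where s: "s = (i, j, k)" by (cases s)
  obtain i' j' k' where t: "t = (i', j', k')" by (cases t)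
  show "(case s of (i, j, k) \<Rightarrow> x [^] i \<otimes> (y [^] j \<otimes> z [^] k)) \<in> carrier G"
    using closed by (simp add: s)
  have "x [^] i \<otimes> (y [^] j \<otimes> z [^] k) \<otimes> (x [^] i' \<otimes> (y [^] j' \<otimes> z [^] k'))
      = x [^] i \<otimes> (y [^] j \<otimes> ((z [^] k \<otimes> x [^] i') \<otimes> (y [^] j' \<otimes> z [^] k')))"
    using closed by (simp add: m_assoc)
  also have "\<dots> = x [^] i \<otimes> ((y [^] j \<otimes> x [^] i') \<otimes> ((z [^] k \<otimes> y [^] j') \<otimes> z [^] k'))"
    using closed by (simp add: zx' m_assoc)
  also have "\<dots> = (x [^] i \<otimes> x [^] i') \<otimes> (y [^] j \<otimes> ((z [^] (- (i' * j)) \<otimes> y [^] j') \<otimes> (z [^] k \<otimes> z [^] k')))"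
    using closed by (simp add: zy zy' yx m_assoc)
  also have "\<dots> = (x [^] i \<otimes> x [^] i') \<otimes> ((y [^] j \<otimes> y [^] j') \<otimes> (z [^] (- (i' * j)) \<otimes> (z [^] k \<otimes> z [^] k')))"
    using closed by (simp add: zy zy' m_assoc)
  also have "\<dots> = x [^] (i + i') \<otimes> (y [^] (j + j') \<otimes> z [^] (k + k' - i' * j))"
    using closed by (simp add: algebra_simps flip: int_pow_mult)
  finally show "(case s \<otimes>\<^bsub>heis_int\<^esub> t of (i, j, k) \<Rightarrow> x [^] i \<otimes> (y [^] j \<otimes> z [^] k))
      = (case s of (i, j, k) \<Rightarrow> x [^] i \<otimes> (y [^] j \<otimes> z [^] k))
        \<otimes> (case t of (i, j, k) \<Rightarrow> x [^] i \<otimes> (y [^] j \<otimes> z [^] k))"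
    by (simp add: s t)
qed

end

lemma inv_heis_int: "inv\<^bsub>heis_int\<^esub> (i, j, k) = (- i, - j, - k - i * j)"
  by (rule group.inv_equality[OF group_heis_int]) auto

text \<open>The normal form map \<open>?psi\<close> has the left inverse \<open>h\<close> supplied
  by the universal property, so it is injective; its image is a subgroup containing the generators,
  so it is surjective.\<close>

lemma heisenberg3_iso_heis_int: "heisenberg3 \<cong> heis_int"
proof -
  define R where "R = {(comm_gword (gen HA) (gen HC), []), (comm_gword (gen HB) (gen HC), []),
    (comm_gword (gen HA) (gen HB), gen HC)}"
  have heis: "heisenberg3 = presented_group UNIV R"
    by (simp add: heisenberg3_def R_def)
  interpret H: group heisenberg3 unfolding heis by (rule group_presented_group)
  interpret T: group heis_int by (rule group_heis_int)
  define g where "g = pres_gen UNIV R"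
  have g: "g x \<in> carrier heisenberg3" for x by (simp add: g_def heis)
  have rel: "eval_gword heisenberg3 g u = eval_gword heisenberg3 g v" if "(u, v) \<in> R" for u v
    using presented_group_relation[OF that, of UNIV] by (simp add: g_def heis gwords_def)
  have "g HA \<otimes>\<^bsub>heisenberg3\<^esub> g HC = g HC \<otimes>\<^bsub>heisenberg3\<^esub> g HA"
    "g HB \<otimes>\<^bsub>heisenberg3\<^esub> g HC = g HC \<otimes>\<^bsub>heisenberg3\<^esub> g HB"
    "g HA \<otimes>\<^bsub>heisenberg3\<^esub> g HB = g HC \<otimes>\<^bsub>heisenberg3\<^esub> (g HB \<otimes>\<^bsub>heisenberg3\<^esub> g HA)"
    using rel[of "comm_gword (gen HA) (gen HC)" "[]"] rel[of "comm_gword (gen HB) (gen HC)" "[]"]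
      rel[of "comm_gword (gen HA) (gen HB)" "gen HC"] g
    by (simp_all add: R_def H.eval_gword_comm H.eval_gword_gen H.commutator_eq_iff)
  note psi = H.heis_int_hom[OF g g g this]
  define f :: "heis_gen \<Rightarrow> int \<times> int \<times> int"
    where "f x = (case x of HA \<Rightarrow> (1, 0, 0) | HB \<Rightarrow> (0, 1, 0) | HC \<Rightarrow> (0, 0, 1))" for x
  obtain h where h: "h \<in> hom heisenberg3 heis_int" "\<And>x. h (g x) = f x"
  proof (rule T.presented_group_lift[of f UNIV R])
    show "eval_gword heis_int f u = eval_gword heis_int f v" if "(u, v) \<in> R" for u v
      using that
      by (auto simp: R_def T.eval_gword_comm T.eval_gword_gen T.commutator_eq_iff)
        (auto simp: f_def inv_heis_int)
  qed (auto simp: g_def heis)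
  let ?psi = "\<lambda>(i :: int, j :: int, k :: int). g HA [^]\<^bsub>heisenberg3\<^esub> i \<otimes>\<^bsub>heisenberg3\<^esub>
    (g HB [^]\<^bsub>heisenberg3\<^esub> j \<otimes>\<^bsub>heisenberg3\<^esub> g HC [^]\<^bsub>heisenberg3\<^esub> k)"
  have left: "h (?psi t) = t" for t
    using g by (cases t)
      (simp add: hom_mult[OF h(1)] hom_int_pow[OF h(1) _ H.is_group T.is_group] h(2) f_def)
  interpret psi: group_hom heis_int heisenberg3 ?psi
    by (intro group_hom.intro group_hom_axioms.intro psi H.is_group T.is_group)
  have gen: "g x \<in> range ?psi" for x
  proof (cases x)
    case HA then show ?thesis using g by (intro image_eqI[of _ _ "(1, 0, 0)"]) auto
  next
    case HB then show ?thesis using g by (intro image_eqI[of _ _ "(0, 1, 0)"]) auto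
  next
    case HC then show ?thesis using g by (intro image_eqI[of _ _ "(0, 0, 1)"]) auto
  qed
  have sub: "subgroup (range ?psi) heisenberg3" using psi.img_is_subgroup by simp
  have "carrier heisenberg3 \<subseteq> range ?psi"
    unfolding heis
    by (rule presented_group_subset_subgroup[OF sub[unfolded heis]])
      (fold g_def, rule gen[unfolded heis])
  with subgroup.subset[OF sub] have "range ?psi = carrier heisenberg3"
    by (rule subset_antisym)
  moreover have "inj ?psi" using left by (rule inj_on_inverseI)
  ultimately have "?psi \<in> iso heis_int heisenberg3"
    using psi unfolding iso_def bij_betw_def by simp
  then show ?thesis by (rule T.iso_sym[OF is_isoI])
qed


section \<open>The right-angled Artin group\<close>

definition raag_gen :: "'a set \<Rightarrow> 'a set set \<Rightarrow> 'a \<Rightarrow> 'a gword set" where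
  "raag_gen V E = pres_gen V
    {(comm_gword (gen v) (gen w), []) | v w. v \<in> V \<and> w \<in> V \<and> {v, w} \<in> E}"

lemma group_raag: "group (raag V E)"
  unfolding raag_def by (rule group_presented_group)

lemma raag_gen_closed [simp]: "v \<in> V \<Longrightarrow> raag_gen V E v \<in> carrier (raag V E)"
  by (simp add: raag_def raag_gen_def)

lemma raag_gen_commute:
  assumes v: "v \<in> V" and w: "w \<in> V" and e: "{v, w} \<in> E"
  shows "raag_gen V E v \<otimes>\<^bsub>raag V E\<^esub> raag_gen V E w = raag_gen V E w \<otimes>\<^bsub>raag V E\<^esub> raag_gen V E v"
proof -
  interpret group "raag V E" by (rule group_raag)
  have "eval_gword (raag V E) (raag_gen V E) (comm_gword (gen v) (gen w)) =
      eval_gword (raag V E) (raag_gen V E) []"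
    unfolding raag_def raag_gen_def
    by (rule presented_group_relation)
      (use assms in \<open>auto simp: comm_gword_def inv_gword_in_gwords\<close>)
  then show ?thesis using v w by (simp add: eval_gword_comm commutator_eq_iff)
qed

lemma raag_hom_eqI:
  assumes "group K" "h \<in> hom (raag V E) K" "k \<in> hom (raag V E) K"
    and "\<And>v. v \<in> V \<Longrightarrow> h (raag_gen V E v) = k (raag_gen V E v)"
    and "X \<in> carrier (raag V E)"
  shows "h X = k X"
  using presented_group_hom_eqI[OF assms(1)] assms(2-) unfolding raag_def raag_gen_def by blast

text \<open>The defining relators are commutators of adjacent vertices, so they die exactly when the
  images of adjacent vertices commute.\<close>

lemma (in group) raag_lift:
  assumes f: "f \<in> V \<rightarrow> carrier G"
    and comm: "\<And>v w. v \<in> V \<Longrightarrow> w \<in> V \<Longrightarrow> {v, w} \<in> E \<Longrightarrow> f v \<otimes> f w = f w \<otimes> f v"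
  obtains h where "h \<in> hom (raag V E) G" "\<And>v. v \<in> V \<Longrightarrow> h (raag_gen V E v) = f v"
proof -
  have "eval_gword G f (comm_gword (gen v) (gen w)) = \<one>"
    if "v \<in> V" "w \<in> V" "{v, w} \<in> E" for v w
  proof -
    have "f v \<in> carrier G" "f w \<in> carrier G" using f that by auto
    then show ?thesis
      using commutator_eq_iff[of "f v" "f w" \<one>] comm[OF that] by (simp add: eval_gword_comm)
  qed
  then have rels: "eval_gword G f u = eval_gword G f v"
    if "(u, v) \<in> {(comm_gword (gen v) (gen w), []) | v w. v \<in> V \<and> w \<in> V \<and> {v, w} \<in> E}" for u v
    using that by auto
  show ?thesis
    by (rule presented_group_lift[OF f rels]) (assumption, auto simp: raag_def raag_gen_def intro: that)
qed

text \<open>Only the images of \<open>c\<close> and \<open>d\<close> can fail to commute, and no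
  edge joins these two. The map serves to detect powers of one vertex that commute with the
  other.\<close>

lemma raag_hom_heis_int:
  assumes "{c, d} \<notin> E"
  obtains h where "h \<in> hom (raag V E) heis_int"
    and "\<And>v. v \<in> V \<Longrightarrow> h (raag_gen V E v) =
      (if v = c then (1, 0, 0) else if v = d then (0, 1, 0) else (0, 0, 0))"
  by (rule group.raag_lift[OF group_heis_int, where E = E and V = V and
      f = "\<lambda>v. if v = c then (1, 0, 0) else if v = d then (0, 1, 0) else (0, 0, 0)"])
    (use assms in \<open>auto simp: insert_commute\<close>)


section \<open>Actions by automorphisms\<close>

text \<open>An action by endomorphisms is automatically one by automorphisms, because the inverse of
  \<open>s\<close> acts as the inverse map. The restriction is there because elements of
  \<open>Bij\<close> are extensional.\<close>

lemma AutoGroup_hom_of_action: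
  assumes "group G" "group T"
    and hom: "\<And>s. s \<in> carrier T \<Longrightarrow> act s \<in> hom G G"
    and one: "\<And>g. g \<in> carrier G \<Longrightarrow> act \<one>\<^bsub>T\<^esub> g = g"
    and mult: "\<And>s t g. s \<in> carrier T \<Longrightarrow> t \<in> carrier T \<Longrightarrow> g \<in> carrier G \<Longrightarrow>
      act (s \<otimes>\<^bsub>T\<^esub> t) g = act s (act t g)"
  shows "(\<lambda>s. restrict (act s) (carrier G)) \<in> hom T (AutoGroup G)"
proof -
  interpret G: group G by fact
  interpret T: group T by fact
  have closed: "act s g \<in> carrier G" if "s \<in> carrier T" "g \<in> carrier G" for s g
    using hom[OF that(1)] that(2) by (rule hom_in_carrier)
  have bij: "restrict (act s) (carrier G) \<in> Bij (carrier G)" if s: "s \<in> carrier T" for s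
  proof -
    have "act (inv\<^bsub>T\<^esub> s) (act s g) = g" "act s (act (inv\<^bsub>T\<^esub> s) g) = g" if "g \<in> carrier G" for g
      using s that by (simp_all add: one flip: mult)
    then have "bij_betw (act s) (carrier G) (carrier G)"
      using s closed by (intro bij_betwI[where g = "act (inv\<^bsub>T\<^esub> s)"]) auto
    then show ?thesis by (simp add: Bij_def)
  qed
  have "restrict (act s) (carrier G) \<in> hom G G" if "s \<in> carrier T" for s
    using hom[OF that] by (auto simp: hom_def)
  with bij show ?thesis
    by (intro homI)
      (auto simp: AutoGroup_def auto_def BijGroup_def mult closed compose_def fun_eq_iff restrict_def)
qed

lemma (in group) inj_hom_imp_subgroup_iso:
  assumes "group T" "h \<in> hom T G" "inj_on h (carrier T)"
  shows "\<exists>H. subgroup H G \<and> T \<cong> G\<lparr>carrier := H\<rparr>"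
proof -
  interpret h: group_hom T G h
    by (intro group_hom.intro group_hom_axioms.intro assms group_axioms)
  have "h \<in> iso T (G\<lparr>carrier := h ` carrier T\<rparr>)"
    using assms by (auto simp: iso_def hom_def bij_betw_def)
  then show ?thesis using h.img_is_subgroup is_isoI by blast
qed

section \<open>The Heisenberg group acting on the Artin group\<close>

theorem theorem1p1:
  fixes V :: "'a set" and E :: "'a set set" and a b :: 'a
  assumes "simplicial_graph V E"
    and "a \<in> V" and "b \<in> V"
    and "{a, b} \<in> E"
    and "vertex_le V E a b"
    and "\<not> (\<forall>c \<in> V - {b}. {b, c} \<in> E)"
  shows "\<exists>H. subgroup H (AutoGroup (raag V E)) \<and>
             heisenberg3 \<cong> (AutoGroup (raag V E))\<lparr>carrier := H\<rparr>"
proof -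
  obtain c where c: "c \<in> V" "c \<noteq> b" "{b, c} \<notin> E" using assms(6) by blast
  have ab: "a \<noteq> b" using assms(1,4) by (auto simp: simplicial_graph_def)
  have ca: "c \<noteq> a" using c assms(4) by (auto simp: insert_commute)
  have ac: "{a, c} \<notin> E"
    using assms(5) c by (auto simp: vertex_le_def lk_def st_def)
  define G where "G = raag V E"
  define g where "g = raag_gen V E"
  interpret G: group G unfolding G_def by (rule group_raag)
  interpret T: group heis_int by (rule group_heis_int)
  have g [simp]: "v \<in> V \<Longrightarrow> g v \<in> carrier G" for v by (simp add: g_def G_def)
  note [simp] = assms(2,3) c(1)
  have gcomm: "g v \<otimes>\<^bsub>G\<^esub> g w = g w \<otimes>\<^bsub>G\<^esub> g v" if "v \<in> V" "w \<in> V" "{v, w} \<in> E" for v w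
    unfolding g_def G_def using that by (rule raag_gen_commute)
  have gab: "g a \<otimes>\<^bsub>G\<^esub> g b = g b \<otimes>\<^bsub>G\<^esub> g a" by (rule gcomm) (use assms(4) in simp_all)

  \<comment> \<open>Powers of the transvection\<close>
  have bpow: "g b [^]\<^bsub>G\<^esub> n \<otimes>\<^bsub>G\<^esub> g v = g v \<otimes>\<^bsub>G\<^esub> g b [^]\<^bsub>G\<^esub> n"
    if "v \<in> V" "g v \<otimes>\<^bsub>G\<^esub> g b = g b \<otimes>\<^bsub>G\<^esub> g v" for v and n :: int
    using G.int_pow_commute[of "g b" "g v" n] that by simp
  \<comment> \<open>Here \<open>a \<le> b\<close> enters: a neighbour of \<open>a\<close> is
    \<open>b\<close> itself or a neighbour of \<open>b\<close>. Hence multiplying \<open>a\<close>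
    by powers of \<open>b\<close> preserves the relations.\<close>
  have star: "g v \<otimes>\<^bsub>G\<^esub> g b = g b \<otimes>\<^bsub>G\<^esub> g v" if "v \<in> V" "{a, v} \<in> E" for v
  proof -
    have "v = b \<or> {b, v} \<in> E" using assms(5) that by (auto simp: vertex_le_def lk_def st_def)
    then show ?thesis using gcomm[of b v] that by auto
  qed
  \<comment> \<open>All integer powers of the transvection are built at once as endomorphisms;
    \<open>tau_0\<close> and \<open>tau_add\<close> then make them mutually inverse in
    pairs.\<close>
  have "\<exists>t. t \<in> hom G G \<and> (\<forall>v\<in>V. t (g v) = (if v = a then g a \<otimes>\<^bsub>G\<^esub> g b [^]\<^bsub>G\<^esub> n else g v))"
    for n :: int
  proof -
    have aux: "(g a \<otimes>\<^bsub>G\<^esub> g b [^]\<^bsub>G\<^esub> n) \<otimes>\<^bsub>G\<^esub> g v = g v \<otimes>\<^bsub>G\<^esub> (g a \<otimes>\<^bsub>G\<^esub> g b [^]\<^bsub>G\<^esub> n)"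
      if v: "v \<in> V" "{a, v} \<in> E" for v
    proof -
      have "g a \<otimes>\<^bsub>G\<^esub> (g b [^]\<^bsub>G\<^esub> n \<otimes>\<^bsub>G\<^esub> g v) = (g a \<otimes>\<^bsub>G\<^esub> g v) \<otimes>\<^bsub>G\<^esub> g b [^]\<^bsub>G\<^esub> n"
        using v by (simp add: bpow star G.m_assoc)
      also have "\<dots> = (g v \<otimes>\<^bsub>G\<^esub> g a) \<otimes>\<^bsub>G\<^esub> g b [^]\<^bsub>G\<^esub> n" using gcomm[of a v] v by simp
      finally show ?thesis using v by (simp add: G.m_assoc)
    qed
    obtain t where "t \<in> hom (raag V E) G"
      "\<And>v. v \<in> V \<Longrightarrow> t (raag_gen V E v) = (if v = a then g a \<otimes>\<^bsub>G\<^esub> g b [^]\<^bsub>G\<^esub> n else g v)"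
    proof (rule G.raag_lift[where E = E and V = V and
        f = "\<lambda>v. if v = a then g a \<otimes>\<^bsub>G\<^esub> g b [^]\<^bsub>G\<^esub> n else g v"])
      fix v w assume "v \<in> V" "w \<in> V" "{v, w} \<in> E"
      then show "(if v = a then g a \<otimes>\<^bsub>G\<^esub> g b [^]\<^bsub>G\<^esub> n else g v) \<otimes>\<^bsub>G\<^esub>
          (if w = a then g a \<otimes>\<^bsub>G\<^esub> g b [^]\<^bsub>G\<^esub> n else g w) =
          (if w = a then g a \<otimes>\<^bsub>G\<^esub> g b [^]\<^bsub>G\<^esub> n else g w) \<otimes>\<^bsub>G\<^esub>
          (if v = a then g a \<otimes>\<^bsub>G\<^esub> g b [^]\<^bsub>G\<^esub> n else g v)"
        using aux[of w] aux[of v] gcomm[of v w] by (auto simp: insert_commute)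
    qed auto
    then show ?thesis unfolding G_def[symmetric] g_def[symmetric] by blast
  qed
  then obtain tau where tau: "\<And>n :: int. tau n \<in> hom G G"
    and tau_gen: "\<And>n v. v \<in> V \<Longrightarrow>
      tau n (g v) = (if v = a then g a \<otimes>\<^bsub>G\<^esub> g b [^]\<^bsub>G\<^esub> n else g v)"
    by metis
  have tau_closed [simp]: "x \<in> carrier G \<Longrightarrow> tau n x \<in> carrier G" for n x
    using tau[of n] by (auto simp: hom_def)
  have tau_mult: "tau n (x \<otimes>\<^bsub>G\<^esub> y) = tau n x \<otimes>\<^bsub>G\<^esub> tau n y"
    if "x \<in> carrier G" "y \<in> carrier G" for n x y
    using tau[of n] that by (rule hom_mult)
  have tau_pow: "tau n (x [^]\<^bsub>G\<^esub> m) = tau n x [^]\<^bsub>G\<^esub> m" if "x \<in> carrier G" for n x and m :: int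
    using hom_int_pow[OF tau that G.is_group G.is_group] .
  have tau_inv: "tau n (inv\<^bsub>G\<^esub> x) = inv\<^bsub>G\<^esub> tau n x" if "x \<in> carrier G" for n x
    using tau_pow[OF that, of n "- 1"] that by (simp add: G.int_pow_neg)
  note eqI = raag_hom_eqI[OF G.is_group, where V = V and E = E, folded G_def g_def]
  have tau_0: "tau 0 x = x" if "x \<in> carrier G" for x
  proof (rule eqI[OF tau _ _ that, of "\<lambda>x. x"])
    show "(\<lambda>x. x) \<in> hom G G" by (rule homI) simp_all
    show "tau 0 (g v) = g v" if "v \<in> V" for v using that by (simp add: tau_gen)
  qed
  \<comment> \<open>It suffices to compare generators. As \<open>a \<noteq> b\<close>,
    \<open>tau m\<close> fixes \<open>g b\<close>, so on \<open>g a\<close> the exponents of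
    \<open>g b\<close> add up.\<close>
  have tau_add: "tau m (tau n x) = tau (m + n) x" if "x \<in> carrier G" for m n x
  proof (rule eqI[of "\<lambda>x. tau m (tau n x)" "tau (m + n)"])
    show "(\<lambda>x. tau m (tau n x)) \<in> hom G G"
      by (intro homI) (simp_all add: tau_mult)
    show "tau m (tau n (g v)) = tau (m + n) (g v)" if "v \<in> V" for v
      using that ab by (auto simp: tau_gen tau_mult tau_pow G.m_assoc G.int_pow_mult)
  qed (rule tau, rule that)

  \<comment> \<open>The subgroup generated by \<open>a\<close> and \<open>b\<close>, and the
    action\<close>
  define p where "p j k = g a [^]\<^bsub>G\<^esub> j \<otimes>\<^bsub>G\<^esub> g b [^]\<^bsub>G\<^esub> k" for j k :: int
  have p [simp]: "p j k \<in> carrier G" for j k by (simp add: p_def)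
  have pab: "g b [^]\<^bsub>G\<^esub> k \<otimes>\<^bsub>G\<^esub> g a [^]\<^bsub>G\<^esub> j = g a [^]\<^bsub>G\<^esub> j \<otimes>\<^bsub>G\<^esub> g b [^]\<^bsub>G\<^esub> k" for j k :: int
    using G.int_pow_commute[of "g a" "g b [^]\<^bsub>G\<^esub> k" j] bpow[of a k] gab by simp
  have p_mult: "p j k \<otimes>\<^bsub>G\<^esub> p j' k' = p (j + j') (k + k')" for j k j' k'
  proof -
    have "p j k \<otimes>\<^bsub>G\<^esub> p j' k' =
        g a [^]\<^bsub>G\<^esub> j \<otimes>\<^bsub>G\<^esub> ((g b [^]\<^bsub>G\<^esub> k \<otimes>\<^bsub>G\<^esub> g a [^]\<^bsub>G\<^esub> j') \<otimes>\<^bsub>G\<^esub> g b [^]\<^bsub>G\<^esub> k')"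
      by (simp add: p_def G.m_assoc)
    then show ?thesis by (simp add: pab p_def G.m_assoc G.int_pow_mult)
  qed
  \<comment> \<open>The transvections act on the exponents of these products by shears.\<close>
  have tau_p: "tau n (p j k) = p j (k + n * j)" for n j k
  proof -
    have "(g a \<otimes>\<^bsub>G\<^esub> g b [^]\<^bsub>G\<^esub> n) [^]\<^bsub>G\<^esub> j = g a [^]\<^bsub>G\<^esub> j \<otimes>\<^bsub>G\<^esub> g b [^]\<^bsub>G\<^esub> (n * j)"
      using G.int_pow_mult_distrib[of "g a" "g b [^]\<^bsub>G\<^esub> n" j] bpow[of a n] gab
      by (simp add: G.int_pow_pow)
    then show ?thesis
      using ab by (simp add: p_def tau_mult tau_pow tau_gen G.m_assoc G.int_pow_mult add.commute[of k])
  qed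
  \<comment> \<open>This is the normal form \<open>A\<^sup>i B\<^sup>j C\<^sup>k\<close> evaluated
    at the transvection and the conjugations by \<open>a\<close> and \<open>b\<close>: conjugate
    first, then apply \<open>tau i\<close>.\<close>
  define act where "act = (\<lambda>(i, j, k) x. tau i (p j k \<otimes>\<^bsub>G\<^esub> x \<otimes>\<^bsub>G\<^esub> inv\<^bsub>G\<^esub> p j k))"
  have act: "(\<lambda>s. restrict (act s) (carrier G)) \<in> hom heis_int (AutoGroup G)"
  proof (rule AutoGroup_hom_of_action[OF G.is_group T.is_group])
    fix s :: "int \<times> int \<times> int"
    obtain i j k where s: "s = (i, j, k)" by (cases s)
    show "act s \<in> hom G G"
    proof (rule homI)
      fix x y assume x: "x \<in> carrier G" and y: "y \<in> carrier G"
      have "inv\<^bsub>G\<^esub> p j k \<otimes>\<^bsub>G\<^esub> (p j k \<otimes>\<^bsub>G\<^esub> (y \<otimes>\<^bsub>G\<^esub> inv\<^bsub>G\<^esub> p j k)) = y \<otimes>\<^bsub>G\<^esub> inv\<^bsub>G\<^esub> p j k"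
        using y by (simp flip: G.m_assoc)
      then show "act s (x \<otimes>\<^bsub>G\<^esub> y) = act s x \<otimes>\<^bsub>G\<^esub> act s y"
        using x y by (simp add: s act_def G.m_assoc flip: tau_mult)
    qed (simp add: s act_def)
    fix t :: "int \<times> int \<times> int" and x assume x: "x \<in> carrier G"
    obtain i' j' k' where t: "t = (i', j', k')" by (cases t)
    have q: "p (j + j') (k + k' - i' * j) = p j (k - i' * j) \<otimes>\<^bsub>G\<^esub> p j' k'"
      by (simp add: p_mult algebra_simps)
    \<comment> \<open>Conjugation by \<open>p j k\<close> is pulled through \<open>tau i'\<close>.
      The shear produces precisely the twist \<open>- i' * j\<close> in the multiplication of
      \<open>heis_int\<close>.\<close>
    have "p j k = tau i' (p j (k - i' * j))" by (simp add: tau_p)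
    then have "act s (act t x) =
        tau i (tau i' (p j (k - i' * j) \<otimes>\<^bsub>G\<^esub> (p j' k' \<otimes>\<^bsub>G\<^esub> x \<otimes>\<^bsub>G\<^esub> inv\<^bsub>G\<^esub> p j' k') \<otimes>\<^bsub>G\<^esub>
          inv\<^bsub>G\<^esub> p j (k - i' * j)))"
      using x by (simp add: s t act_def tau_mult tau_inv)
    also have "\<dots> = act (s \<otimes>\<^bsub>heis_int\<^esub> t) x"
      using x by (simp add: s t act_def tau_add q G.inv_mult_group G.m_assoc)
    finally show "act (s \<otimes>\<^bsub>heis_int\<^esub> t) x = act s (act t x)" ..
  next
    fix x assume "x \<in> carrier G"
    then show "act \<one>\<^bsub>heis_int\<^esub> x = x" by (simp add: act_def p_def tau_0)
  qed

  \<comment> \<open>Faithfulness of the action\<close>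
  obtain hb where hb: "hb \<in> hom G heis_int"
    and hb_gen: "\<And>v. v \<in> V \<Longrightarrow> hb (g v) = (if v = b then (1, 0, 0) else if v = c then (0, 1, 0) else (0, 0, 0))"
    using raag_hom_heis_int[OF c(3), of V] unfolding G_def g_def by blast
  obtain ha where ha: "ha \<in> hom G heis_int"
    and ha_gen: "\<And>v. v \<in> V \<Longrightarrow> ha (g v) = (if v = a then (1, 0, 0) else if v = c then (0, 1, 0) else (0, 0, 0))"
    using raag_hom_heis_int[OF ac, of V] unfolding G_def g_def by blast
  have one_pow: "(0, 0, 0) [^]\<^bsub>heis_int\<^esub> (n :: int) = (0, 0, 0)" for n
    using T.int_pow_one[of n] by simp
  \<comment> \<open>\<open>hb\<close> kills \<open>a\<close> and \<open>ha\<close> kills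
    \<open>b\<close>, so each reads off one exponent.\<close>
  have hom_p: "hb (p j k) = (k, 0, 0)" "ha (p j k) = (j, 0, 0)" for j k
    using ab ca c(2)
    by (simp_all add: p_def hom_mult[OF hb] hom_mult[OF ha] hb_gen ha_gen one_pow
        hom_int_pow[OF hb _ G.is_group T.is_group] hom_int_pow[OF ha _ G.is_group T.is_group])
  have ker: "s = (0, 0, 0)" if id: "\<And>x. x \<in> carrier G \<Longrightarrow> act s x = x" for s
  proof -
    obtain i j k where s: "s = (i, j, k)" by (cases s)
    have "p j k \<otimes>\<^bsub>G\<^esub> g a = g a \<otimes>\<^bsub>G\<^esub> p j k"
      using p_mult[of j k 1 0] p_mult[of 1 0 j k] by (simp add: p_def add.commute)
    then have "p j k \<otimes>\<^bsub>G\<^esub> g a \<otimes>\<^bsub>G\<^esub> inv\<^bsub>G\<^esub> p j k = g a" by (simp add: G.m_assoc)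
    \<comment> \<open>The conjugating element commutes with \<open>g a\<close>, so only
      \<open>tau i\<close> affects \<open>g a\<close>; applying \<open>hb\<close> then isolates
      \<open>i\<close>.\<close>
    then have "p 1 i = g a" using id[of "g a"] tau_gen[of a i] by (simp add: s act_def p_def)
    then have i: "i = 0" using hom_p(1)[of 1 i] ab by (simp add: hb_gen split: if_splits)
    have "p j k \<otimes>\<^bsub>G\<^esub> g c \<otimes>\<^bsub>G\<^esub> inv\<^bsub>G\<^esub> p j k = g c"
      using id[of "g c"] by (simp add: s act_def i tau_0)
    then have pc: "p j k \<otimes>\<^bsub>G\<^esub> g c = g c \<otimes>\<^bsub>G\<^esub> p j k" by (subst (asm) G.inv_solve_right') simp_all
    \<comment> \<open>Under \<open>hb\<close> the two sides of \<open>pc\<close> become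
      \<open>(k, 1, 0)\<close> and \<open>(k, 1, - k)\<close>; \<open>ha\<close> does the same for
      \<open>j\<close>.\<close>
    have "k = 0" using arg_cong[OF pc, of hb] c(2) by (simp add: hom_mult[OF hb] hom_p hb_gen)
    moreover have "j = 0"
      using arg_cong[OF pc, of ha] ca by (simp add: hom_mult[OF ha] hom_p ha_gen)
    ultimately show ?thesis by (simp add: s i)
  qed
  interpret A: group "AutoGroup G" by (rule G.AutoGroup)
  interpret act: group_hom heis_int "AutoGroup G" "\<lambda>s. restrict (act s) (carrier G)"
    by (intro group_hom.intro group_hom_axioms.intro act A.is_group T.is_group)
  have "inj_on (\<lambda>s. restrict (act s) (carrier G)) (carrier heis_int)"
    unfolding act.inj_on_one_iff
  proof (intro allI impI)
    fix s assume "restrict (act s) (carrier G) = \<one>\<^bsub>AutoGroup G\<^esub>"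
    then have "restrict (act s) (carrier G) x = (\<lambda>x\<in>carrier G. x) x" for x
      by (simp add: AutoGroup_def BijGroup_def)
    then have "act s x = x" if "x \<in> carrier G" for x
      using that by (metis restrict_apply')
    then show "s = \<one>\<^bsub>heis_int\<^esub>" using ker by simp
  qed
  from A.inj_hom_imp_subgroup_iso[OF T.is_group act this]
  show ?thesis using heisenberg3_iso_heis_int unfolding G_def by (blast intro: iso_trans)
qed

end
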